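(* Let $F:V\to\mathbb R$ be convex and $L_F$-smooth ($L_F>0$), let $\mu>0$ and let $N:V\to V$ be $\mu$-strongly monotone, i.e. $(N(x)-N(y),x-y)\ge\mu\|x-y\|^2$ for all $x,y\in V$. Let $x^\star$ satisfy $\nabla F(x^\star)+N(x^\star)=0$. Let $(x_k,y_k)_{k\ge0}$ be generated by the predictor-corrector (EPC-VOS) scheme $$\frac{\tilde x_{k+1}-x_k}{\alpha}=y_k-\tilde x_{k+1},\qquad \frac{y_{k+1}-y_k}{\alpha}=-\frac1\mu\big(\nabla F(\tilde x_{k+1})+N(y_{k+1})\big),\qquad \frac{x_{k+1}-x_k}{\alpha}=y_{k+1}-x_{k+1},$$ with $\alpha=\sqrt{\mu/L_F}$. Then, with $\mathcal E(x,y)=D_F(x,x^\star)+\frac\mu2\|y-x^\star\|^2$, $$\mathcal E(x_{k+1},y_{k+1})\ \le\ \frac{1}{1+\sqrt{\mu/L_F}}\ \mathcal E(x_k,y_k),\qquad k\ge0.$$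
   Context: $V$ is a real Hilbert space with inner product $(\cdot,\cdot)$ and norm $\|\cdot\|$, identified with its dual; $\langle\cdot,\cdot\rangle$ is the duality pairing (inner product). $F$ is $L_F$-smooth if it is continuously differentiable with $L_F$-Lipschitz gradient. The Bregman divergence is $D_F(y,x)=F(y)-F(x)-\langle\nabla F(x),y-x\rangle$. *)

theory Defs
  imports "HOL-Analysis.Analysis"
begin

text \<open>
  A real Hilbert space is a type of sort \<open>{real_inner, complete_space}\<close>. Identifying the space
  with its dual turns the duality pairing into the inner product, so the gradient is the vector
  representing the Frechet derivative. If no such vector exists, \<open>grad F x\<close> is unspecified.
\<close>

definition grad :: "('v::real_inner \<Rightarrow> real) \<Rightarrow> 'v \<Rightarrow> 'v" where
  "grad F x = (THE g. GDERIV F x :> g)"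

definition smooth_with :: "real \<Rightarrow> ('v::real_inner \<Rightarrow> real) \<Rightarrow> bool" where
  "smooth_with L F \<longleftrightarrow>
     (\<forall>x. \<exists>g. GDERIV F x :> g) \<and>
     continuous_on UNIV (grad F) \<and>
     L-lipschitz_on UNIV (grad F)"

definition bregman :: "('v::real_inner \<Rightarrow> real) \<Rightarrow> 'v \<Rightarrow> 'v \<Rightarrow> real" where
  "bregman F y x = F y - F x - grad F x \<bullet> (y - x)"

definition strongly_monotone :: "real \<Rightarrow> ('v::real_inner \<Rightarrow> 'v) \<Rightarrow> bool" where
  "strongly_monotone \<mu> N \<longleftrightarrow> (\<forall>x y. (N x - N y) \<bullet> (x - y) \<ge> \<mu> * (norm (x - y))\<^sup>2)"

text \<open>
  The sequence \<open>xt\<close> holds the predictors; only \<open>xt (Suc k)\<close> is constrained, \<open>xt 0\<close> plays no role.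
  The corrector for \<open>y\<close> is implicit in \<open>N\<close>, so the scheme is a relation between sequences.
\<close>

definition epc_vos ::
  "('v::real_inner \<Rightarrow> real) \<Rightarrow> ('v \<Rightarrow> 'v) \<Rightarrow> real \<Rightarrow> real \<Rightarrow>
   (nat \<Rightarrow> 'v) \<Rightarrow> (nat \<Rightarrow> 'v) \<Rightarrow> (nat \<Rightarrow> 'v) \<Rightarrow> bool" where
  "epc_vos F N \<mu> \<alpha> xt x y \<longleftrightarrow>
     (\<forall>k. (xt (Suc k) - x k) /\<^sub>R \<alpha> = y k - xt (Suc k) \<and>
          (y (Suc k) - y k) /\<^sub>R \<alpha> = - ((1 / \<mu>) *\<^sub>R (grad F (xt (Suc k)) + N (y (Suc k)))) \<and>
          (x (Suc k) - x k) /\<^sub>R \<alpha> = y (Suc k) - x (Suc k))"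

definition lyapunov :: "('v::real_inner \<Rightarrow> real) \<Rightarrow> real \<Rightarrow> 'v \<Rightarrow> 'v \<Rightarrow> 'v \<Rightarrow> real" where
  "lyapunov F \<mu> xstar x y = bregman F x xstar + \<mu> / 2 * (norm (y - xstar))\<^sup>2"

end

theory Submission
  imports Defs
begin

text \<open>
  Write \<open>s\<close> for the equilibrium, \<open>a\<close> for the step size, and \<open>(p, u, v)\<close> for the predictor and the
  corrected pair obtained from \<open>(x, y)\<close>. The function \<open>z \<mapsto> bregman F z s\<close> is convex and
  \<open>L\<close>-smooth, vanishes at \<open>s\<close>, and has gradient \<open>h = grad F p - grad F s\<close> at \<open>p\<close>. Its increase from
  \<open>x\<close> to \<open>u\<close>, with \<open>a\<close> times the new value added, is estimated from the single point \<open>p\<close>: tangents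
  at \<open>p\<close> lie below the values at \<open>x\<close> and at \<open>s\<close>, and the quadratic upper model at \<open>p\<close> bounds the value
  at \<open>u\<close>. The scheme is made so that all the linear terms collapse to \<open>a * (h \<bullet> (v - s))\<close>.

  The implicit step for \<open>y\<close> turns this term into \<open>- \<mu> * ((v - y) \<bullet> (v - s))\<close> and a strong monotonicity
  term. By the polarization identity the former yields the decrease of the quadratic part of the
  Lyapunov function together with a gain \<open>- \<mu> / 2 * (norm (v - y))\<^sup>2\<close>. Because
  \<open>u - p = (a / (1 + a)) *\<^sub>R (v - y)\<close>, the quadratic model costs
  \<open>L * a\<^sup>2 / (2 * (1 + a)) * (norm (v - y))\<^sup>2\<close>, and the choice \<open>L * a\<^sup>2 = \<mu>\<close> makes the gain pay for it.
\<close>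

lemma gderiv_unique:
  assumes "GDERIV F x :> g" "GDERIV F x :> g'"
  shows "g = g'"
proof -
  have "(\<lambda>h. h \<bullet> g) = (\<lambda>h. h \<bullet> g')"
    using assms unfolding gderiv_def by (rule has_derivative_unique)
  then have "h \<bullet> g = h \<bullet> g'" for h
    by (rule fun_cong)
  then show ?thesis
    by (metis vector_eq_ldot)
qed

lemma smooth_with_gderiv:
  assumes "smooth_with L F"
  shows "GDERIV F x :> grad F x"
proof -
  obtain g where "GDERIV F x :> g"
    using assms unfolding smooth_with_def by blast
  then show ?thesis
    unfolding grad_def by (rule theI) (metis gderiv_unique \<open>GDERIV F x :> g\<close>)
qed

lemma smooth_with_line_derivative:
  assumes "smooth_with L F"
  shows "((\<lambda>t. F (x + t *\<^sub>R d)) has_real_derivative grad F (x + t *\<^sub>R d) \<bullet> d) (at t)"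
proof -
  have "((\<lambda>t. x + t *\<^sub>R d) has_derivative (\<lambda>r. r *\<^sub>R d)) (at t)"
    by (auto intro!: derivative_eq_intros)
  moreover have "(F has_derivative (\<lambda>h. h \<bullet> grad F (x + t *\<^sub>R d))) (at (x + t *\<^sub>R d))"
    using smooth_with_gderiv[OF assms] unfolding gderiv_def .
  ultimately have "((\<lambda>t. F (x + t *\<^sub>R d)) has_derivative
      (\<lambda>r. (r *\<^sub>R d) \<bullet> grad F (x + t *\<^sub>R d))) (at t)"
    by (rule has_derivative_compose)
  then show ?thesis
    unfolding has_field_derivative_def
    by (rule has_derivative_eq_rhs) (simp add: fun_eq_iff inner_commute)
qed

lemma bregman_nonneg:
  assumes "convex_on UNIV F" and smooth: "smooth_with L F"
  shows "0 \<le> bregman F y x"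
proof -
  define f where "f t = F (x + t *\<^sub>R (y - x))" for t
  have "convex_on UNIV f"
  proof (rule convex_onI)
    fix t r q :: real
    assume "0 < t" "t < 1"
    have "x + ((1 - t) *\<^sub>R r + t *\<^sub>R q) *\<^sub>R (y - x)
        = (1 - t) *\<^sub>R (x + r *\<^sub>R (y - x)) + t *\<^sub>R (x + q *\<^sub>R (y - x))"
      by (simp add: algebra_simps)
    then show "f ((1 - t) *\<^sub>R r + t *\<^sub>R q) \<le> (1 - t) * f r + t * f q"
      unfolding f_def using convex_onD[OF assms(1)] \<open>0 < t\<close> \<open>t < 1\<close> by simp
  qed simp
  moreover have "(f has_real_derivative grad F x \<bullet> (y - x)) (at 0)"
    using smooth_with_line_derivative[OF smooth, of x "y - x" 0] by (simp add: f_def[abs_def])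
  ultimately have "f 1 - f 0 \<ge> grad F x \<bullet> (y - x) * (1 - 0)"
    by (intro convex_on_imp_above_tangent[of UNIV]) auto
  then show ?thesis
    by (simp add: f_def bregman_def)
qed

text \<open>
  The descent lemma: along the segment, the slope of \<open>F\<close> exceeds that of its linear model by at most
  \<open>L\<close> times the distance travelled, so subtracting the linear model and the integral of this
  bound leaves a nonincreasing function.
\<close>

lemma bregman_le_square:
  assumes smooth: "smooth_with L F"
  shows "bregman F y x \<le> L / 2 * (norm (y - x))\<^sup>2"
proof -
  define d where "d = y - x"
  define f where "f t = F (x + t *\<^sub>R d) - t * (grad F x \<bullet> d) - L / 2 * (norm d)\<^sup>2 * t\<^sup>2" for t
  have "f 1 \<le> f 0"
  proof (rule DERIV_nonpos_imp_nonincreasing[where f = f and a = 0 and b = 1])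
    fix t :: real
    assume t: "0 \<le> t" "t \<le> 1"
    have "(f has_real_derivative
        grad F (x + t *\<^sub>R d) \<bullet> d - grad F x \<bullet> d - L * (norm d)\<^sup>2 * t) (at t)"
      unfolding f_def
      by (auto intro!: derivative_eq_intros smooth_with_line_derivative[OF smooth])
    moreover have "grad F (x + t *\<^sub>R d) \<bullet> d - grad F x \<bullet> d \<le> L * (norm d)\<^sup>2 * t"
    proof -
      have "dist (grad F (x + t *\<^sub>R d)) (grad F x) \<le> L * dist (x + t *\<^sub>R d) x"
        using smooth unfolding smooth_with_def by (auto elim: lipschitz_onD)
      then have "norm (grad F (x + t *\<^sub>R d) - grad F x) \<le> L * (t * norm d)"
        using t by (simp add: dist_norm)
      then have "norm (grad F (x + t *\<^sub>R d) - grad F x) * norm d \<le> L * (t * norm d) * norm d"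
        by (rule mult_right_mono) simp
      moreover have "(grad F (x + t *\<^sub>R d) - grad F x) \<bullet> d
          \<le> norm (grad F (x + t *\<^sub>R d) - grad F x) * norm d"
        by (rule norm_cauchy_schwarz)
      ultimately show ?thesis
        by (simp add: inner_diff_left power2_eq_square algebra_simps)
    qed
    ultimately show "\<exists>D. (f has_real_derivative D) (at t) \<and> D \<le> 0"
      by (intro exI conjI) auto
  qed simp
  then show ?thesis
    by (simp add: f_def d_def bregman_def)
qed

text \<open>
  The three Bregman divergences based at \<open>p\<close> carry all the nonlinearity of \<open>F\<close>; after using their
  signs and the quadratic bound, what remains is affine in \<open>x\<close>, \<open>u\<close> and \<open>p\<close> and reduces to a multiple
  of \<open>v - s\<close>.
\<close>

lemma bregman_predictor_corrector_bound:
  assumes convex: "convex_on UNIV F" and smooth: "smooth_with L F"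
    and a: "a > 0"
    and predictor: "p - x = a *\<^sub>R (y - p)"
    and corrector: "u - x = a *\<^sub>R (v - u)"
  shows "(1 + a) * bregman F u s - bregman F x s
    \<le> a * ((grad F p - grad F s) \<bullet> (v - s)) + L * a\<^sup>2 / (2 * (1 + a)) * (norm (v - y))\<^sup>2"
proof -
  let ?h = "grad F p - grad F s"
  have up: "(1 + a) *\<^sub>R (u - p) = a *\<^sub>R (v - y)"
    using predictor corrector by (simp add: algebra_simps)
  have "(1 + a) * norm (u - p) = a * norm (v - y)"
    using arg_cong[OF up, of norm] a by simp
  then have norm_up: "norm (u - p) = a * norm (v - y) / (1 + a)"
    using a by (simp add: field_simps)
  \<comment> \<open>The predictor has dropped out: only the corrector relation enters the linear term.\<close>
  have collapse: "(1 + a) *\<^sub>R (u - s) - (x - s) = a *\<^sub>R (v - s)"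
    using corrector by (simp add: algebra_simps)
  have "?h \<bullet> ((1 + a) *\<^sub>R (u - s) - (x - s)) = ?h \<bullet> (a *\<^sub>R (v - s))"
    using collapse by (rule arg_cong)
  then have "(1 + a) * bregman F u s - bregman F x s
      = a * (?h \<bullet> (v - s)) + (1 + a) * bregman F u p - bregman F x p - a * bregman F s p"
    unfolding bregman_def
    by (simp add: inner_diff_left inner_diff_right algebra_simps)
  also have "\<dots> \<le> a * (?h \<bullet> (v - s)) + (1 + a) * bregman F u p"
    using bregman_nonneg[OF convex smooth, of x p]
      mult_nonneg_nonneg[OF less_imp_le[OF a] bregman_nonneg[OF convex smooth, of s p]]
    by linarith
  also have "(1 + a) * bregman F u p \<le> (1 + a) * (L / 2 * (norm (u - p))\<^sup>2)"
    using bregman_le_square[OF smooth, of u p] a by (intro mult_left_mono) auto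
  also have "\<dots> = L * a\<^sup>2 / (2 * (1 + a)) * (norm (v - y))\<^sup>2"
    using a unfolding norm_up by (simp add: power_divide power_mult_distrib power2_eq_square)
  finally show ?thesis
    by simp
qed

text \<open>
  The equilibrium condition replaces \<open>grad F p + N v\<close> by \<open>(grad F p - grad F s) + (N v - N s)\<close>, which
  isolates the strong monotonicity term; the rest is polarization.
\<close>

lemma implicit_step_inner_bound:
  assumes mono: "strongly_monotone \<mu> N"
    and equilibrium: "grad F s + N s = 0"
    and a: "a > 0"
    and step: "\<mu> *\<^sub>R (v - y) = - (a *\<^sub>R (grad F p + N v))"
  shows "a * ((grad F p - grad F s) \<bullet> (v - s))
    \<le> \<mu> / 2 * ((norm (y - s))\<^sup>2 - (1 + 2 * a) * (norm (v - s))\<^sup>2 - (norm (v - y))\<^sup>2)"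
proof -
  have "N s = - grad F s"
    using equilibrium by (simp add: eq_neg_iff_add_eq_0 add.commute)
  then have "a *\<^sub>R (grad F p - grad F s) = - (\<mu> *\<^sub>R (v - y)) - a *\<^sub>R (N v - N s)"
    unfolding step by (simp add: algebra_simps)
  then have "a * ((grad F p - grad F s) \<bullet> (v - s))
      = - (\<mu> * ((v - y) \<bullet> (v - s))) - a * ((N v - N s) \<bullet> (v - s))"
    by (metis inner_diff_left inner_minus_left inner_scaleR_left)
  moreover have "a * ((N v - N s) \<bullet> (v - s)) \<ge> a * (\<mu> * (norm (v - s))\<^sup>2)"
    using mono a unfolding strongly_monotone_def by (intro mult_left_mono) auto
  moreover have polarization: "(v - y) \<bullet> (v - s)
      = ((norm (v - s))\<^sup>2 + (norm (v - y))\<^sup>2 - (norm (y - s))\<^sup>2) / 2"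
    by (simp add: power2_norm_eq_inner inner_diff_left inner_diff_right inner_commute)
  ultimately show ?thesis
    unfolding polarization by (simp add: field_simps)
qed

theorem lyapunov_predictor_corrector_decay:
  assumes convex: "convex_on UNIV F" and smooth: "smooth_with L F"
    and \<mu>: "\<mu> > 0" and mono: "strongly_monotone \<mu> N"
    and equilibrium: "grad F s + N s = 0"
    and a: "a > 0" and La: "L * a\<^sup>2 = \<mu>"
    and predictor: "p - x = a *\<^sub>R (y - p)"
    and step: "\<mu> *\<^sub>R (v - y) = - (a *\<^sub>R (grad F p + N v))"
    and corrector: "u - x = a *\<^sub>R (v - u)"
  shows "(1 + a) * lyapunov F \<mu> s u v \<le> lyapunov F \<mu> s x y"
proof -
  have "(1 + a) * bregman F u s - bregman F x s
      \<le> \<mu> / 2 * ((norm (y - s))\<^sup>2 - (1 + 2 * a) * (norm (v - s))\<^sup>2 - (norm (v - y))\<^sup>2)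
        + \<mu> / (2 * (1 + a)) * (norm (v - y))\<^sup>2"
    using bregman_predictor_corrector_bound[OF convex smooth a predictor corrector, of s]
      implicit_step_inner_bound[OF mono equilibrium a step]
    unfolding La by linarith
  also have "\<mu> / (2 * (1 + a)) * (norm (v - y))\<^sup>2 \<le> \<mu> / 2 * (norm (v - y))\<^sup>2"
    using a \<mu> by (intro mult_right_mono) (auto simp: field_simps)
  finally have "(1 + a) * bregman F u s - bregman F x s
      \<le> \<mu> / 2 * ((norm (y - s))\<^sup>2 - (1 + 2 * a) * (norm (v - s))\<^sup>2)"
    by (simp add: right_diff_distrib)
  also have "\<dots> \<le> \<mu> / 2 * ((norm (y - s))\<^sup>2 - (1 + a) * (norm (v - s))\<^sup>2)"
    using a \<mu> by (intro mult_left_mono diff_left_mono mult_right_mono) auto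
  finally show ?thesis
    unfolding lyapunov_def by (simp add: field_simps)
qed

theorem theorem6p2:
  fixes F :: "'v::{real_inner, complete_space} \<Rightarrow> real"
    and N :: "'v \<Rightarrow> 'v"
    and L\<^sub>F \<mu> :: real
    and xstar :: 'v
    and xt x y :: "nat \<Rightarrow> 'v"
  assumes "convex_on UNIV F"
    and "L\<^sub>F > 0"
    and "smooth_with L\<^sub>F F"
    and "\<mu> > 0"
    and "strongly_monotone \<mu> N"
    and "grad F xstar + N xstar = 0"
    and "epc_vos F N \<mu> (sqrt (\<mu> / L\<^sub>F)) xt x y"
  shows "\<forall>k. lyapunov F \<mu> xstar (x (Suc k)) (y (Suc k))
             \<le> 1 / (1 + sqrt (\<mu> / L\<^sub>F)) * lyapunov F \<mu> xstar (x k) (y k)"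
proof
  fix k
  define a where "a = sqrt (\<mu> / L\<^sub>F)"
  have a: "a > 0" and La: "L\<^sub>F * a\<^sup>2 = \<mu>"
    using assms(2,4) by (simp_all add: a_def)
  have clear_step: "w = a *\<^sub>R z" if "w /\<^sub>R a = z" for w z :: 'v
    using that a by auto
  have predictor: "xt (Suc k) - x k = a *\<^sub>R (y k - xt (Suc k))"
    and dual: "y (Suc k) - y k
      = a *\<^sub>R - ((1 / \<mu>) *\<^sub>R (grad F (xt (Suc k)) + N (y (Suc k))))"
    and corrector: "x (Suc k) - x k = a *\<^sub>R (y (Suc k) - x (Suc k))"
    using assms(7) unfolding epc_vos_def a_def[symmetric] by (blast intro: clear_step)+
  have "\<mu> *\<^sub>R (y (Suc k) - y k) = - (a *\<^sub>R (grad F (xt (Suc k)) + N (y (Suc k))))"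
    unfolding dual using assms(4) by simp
  then have "(1 + a) * lyapunov F \<mu> xstar (x (Suc k)) (y (Suc k)) \<le> lyapunov F \<mu> xstar (x k) (y k)"
    using lyapunov_predictor_corrector_decay[OF assms(1,3-6) a La predictor _ corrector] by blast
  then show "lyapunov F \<mu> xstar (x (Suc k)) (y (Suc k))
      \<le> 1 / (1 + sqrt (\<mu> / L\<^sub>F)) * lyapunov F \<mu> xstar (x k) (y k)"
    using a unfolding a_def[symmetric] by (simp add: field_simps)
qed

end
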